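(* Let $m\in\mathbb{Z}_{\ge0}$ and $B\in G_m$. Then there exist $\ell\ge0$ and matrices $C_1,\dots,C_\ell$ such that for every $j=1,\dots,\ell$, $C_j\in G_{k_j}$ for some $k_j<m$, and $$\tilde B=\tilde B^{\mathrm{f.r.}}+\sum_{j=1}^{\ell}\tilde C_j^{\mathrm{f.r.}}\quad\text{in }\mathcal{CF}_q.$$ Therefore, for every $m\in\mathbb{Z}_{\ge0}$, $\mathcal{R}_{\le m}=\mathcal{R}^{\mathrm{f.r.}}_{\le m}$.
   Context: Fix a prime power $q$. For $N\in\mathbb{Z}_{\ge0}$ let $G_N=\mathrm{GL}_N(q)$ be the general linear group over the field $\mathbb{F}_q$ with $q$ elements ($G_0$ is the trivial group). $\mathcal{CF}_q$ is the $\mathbb{C}$-algebra whose elements are equivalence classes of families of complex class functions, one on $G_N$ for every large enough $N$, where two families are equivalent if they coincide for every large enough $N$; operations are pointwise. For $B\in G_m$ define, for every $N\ge0$ and $g\in G_N$, $\tilde B(g)=\#\{M\in \mathrm{Mat}_{m\times N}(\mathbb{F}_q): Mg=BM\}$ and $\tilde B^{\mathrm{f.r.}}(g)=\#\{M\in \mathrm{Mat}_{m\times N}(\mathbb{F}_q): Mg=BM,\ \mathrm{rank}(M)=m\}$. These define elements of $\mathcal{CF}_q$ (for the unique $B\in G_0$ both are the constant function $1$). $\mathcal{R}_m=\mathrm{span}_{\mathbb{C}}\{\tilde B: B\in G_m\}$, $\mathcal{R}_{\le m}=\sum_{j=0}^m\mathcal{R}_j$, $\mathcal{R}^{\mathrm{f.r.}}_m=\mathrm{span}_{\mathbb{C}}\{\tilde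 B^{\mathrm{f.r.}}: B\in G_m\}$, $\mathcal{R}^{\mathrm{f.r.}}_{\le m}=\sum_{j=0}^m\mathcal{R}^{\mathrm{f.r.}}_j$. *)

theory Defs
  imports "HOL-Library.Set_Algebras" "Jordan_Normal_Form.DL_Rank"
begin

text \<open>The finite field with \<open>q\<close> elements is a type \<open>'a :: {field, finite}\<close> with
  \<open>q = CARD('a)\<close>.\<close>

definition GL :: "nat \<Rightarrow> 'a :: field mat set" where
  "GL N = {g \<in> carrier_mat N N. invertible_mat g}"

definition class_fun :: "nat \<Rightarrow> ('a :: field mat \<Rightarrow> complex) \<Rightarrow> bool" where
  "class_fun N f \<longleftrightarrow> (\<forall>g\<in>GL N. \<forall>h\<in>GL N. similar_mat g h \<longrightarrow> f g = f h)"

text \<open>A family of class functions, one on \<open>GL N\<close> for every large enough \<open>N\<close>, is encoded by a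
  total function. Its values at the remaining \<open>N\<close>, and outside of \<open>GL N\<close>, are
  arbitrary, and \<open>cf_rel\<close> ignores them.\<close>

definition class_family :: "(nat \<Rightarrow> 'a :: field mat \<Rightarrow> complex) \<Rightarrow> bool" where
  "class_family f \<longleftrightarrow> (\<forall>\<^sub>F N in sequentially. class_fun N (f N))"

definition cf_rel ::
    "(nat \<Rightarrow> 'a :: field mat \<Rightarrow> complex) \<Rightarrow> (nat \<Rightarrow> 'a mat \<Rightarrow> complex) \<Rightarrow> bool" where
  "cf_rel f h \<longleftrightarrow> class_family f \<and> class_family h \<and>
     (\<forall>\<^sub>F N in sequentially. \<forall>g\<in>GL N. f N g = h N g)"

lemma class_family_const: "class_family (\<lambda>_ _. c)"
  by (simp add: class_family_def class_fun_def)

lemma class_family_map2: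
  assumes "class_family f" "class_family h"
  shows "class_family (\<lambda>N g. F (f N g) (h N g))"
  using assms unfolding class_family_def
  by eventually_elim (auto simp: class_fun_def intro!: arg_cong2[of _ _ _ _ F])

lemma class_family_map:
  assumes "class_family f"
  shows "class_family (\<lambda>N g. F (f N g))"
  using class_family_map2[OF assms assms, of "\<lambda>x _. F x"] by simp

lemma class_family_ops:
  assumes "class_family f" "class_family h"
  shows "class_family (\<lambda>N g. f N g + h N g)" "class_family (\<lambda>N g. f N g - h N g)"
    "class_family (\<lambda>N g. f N g * h N g)" "class_family (\<lambda>N g. - f N g)"
    "class_family (\<lambda>N g. c * f N g)"
  by (rule class_family_map2[OF assms] class_family_map[OF assms(1)])+

lemma cf_rel_refl: "cf_rel f f \<longleftrightarrow> class_family f"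
  by (simp add: cf_rel_def)

lemma cf_rel_eq: "class_family f \<Longrightarrow> f = h \<Longrightarrow> cf_rel f h"
  by (simp add: cf_rel_refl)

lemma cf_rel_map2:
  assumes "cf_rel f f'" "cf_rel h h'"
  shows "cf_rel (\<lambda>N g. F (f N g) (h N g)) (\<lambda>N g. F (f' N g) (h' N g))"
proof -
  have "\<forall>\<^sub>F N in sequentially. \<forall>g\<in>GL N. f N g = f' N g"
    "\<forall>\<^sub>F N in sequentially. \<forall>g\<in>GL N. h N g = h' N g"
    using assms by (auto simp: cf_rel_def)
  hence "\<forall>\<^sub>F N in sequentially. \<forall>g\<in>GL N. F (f N g) (h N g) = F (f' N g) (h' N g)"
    by eventually_elim simp
  thus ?thesis using assms by (simp add: cf_rel_def class_family_map2)
qed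

lemma cf_rel_map:
  assumes "cf_rel f f'"
  shows "cf_rel (\<lambda>N g. F (f N g)) (\<lambda>N g. F (f' N g))"
  using cf_rel_map2[OF assms assms, of "\<lambda>x _. F x"] by simp

quotient_type (overloaded) 'a cf = "nat \<Rightarrow> 'a :: field mat \<Rightarrow> complex" / partial: cf_rel
proof (rule part_equivpI)
  show "\<exists>f. cf_rel f (f :: nat \<Rightarrow> 'a mat \<Rightarrow> complex)"
    using class_family_const by (auto simp: cf_rel_refl)
  show "symp (cf_rel :: (nat \<Rightarrow> 'a mat \<Rightarrow> complex) \<Rightarrow> _)"
    by (rule sympI) (simp add: cf_rel_def eq_commute)
  show "transp (cf_rel :: (nat \<Rightarrow> 'a mat \<Rightarrow> complex) \<Rightarrow> _)"
  proof (rule transpI)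
    fix f h k :: "nat \<Rightarrow> 'a mat \<Rightarrow> complex"
    assume *: "cf_rel f h" "cf_rel h k"
    have "\<forall>\<^sub>F N in sequentially. \<forall>g\<in>GL N. f N g = h N g"
      "\<forall>\<^sub>F N in sequentially. \<forall>g\<in>GL N. h N g = k N g"
      using * by (auto simp: cf_rel_def)
    hence "\<forall>\<^sub>F N in sequentially. \<forall>g\<in>GL N. f N g = k N g"
      by eventually_elim simp
    thus "cf_rel f k" using * by (simp add: cf_rel_def)
  qed
qed

instantiation cf :: (field) comm_ring_1
begin

lift_definition zero_cf :: "'a cf" is "\<lambda>_ _. 0"
  by (simp add: cf_rel_refl class_family_const)

lift_definition one_cf :: "'a cf" is "\<lambda>_ _. 1"
  by (simp add: cf_rel_refl class_family_const)

lift_definition plus_cf :: "'a cf \<Rightarrow> 'a cf \<Rightarrow> 'a cf" is "\<lambda>f h N g. f N g + h N g"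
  by (rule cf_rel_map2)

lift_definition minus_cf :: "'a cf \<Rightarrow> 'a cf \<Rightarrow> 'a cf" is "\<lambda>f h N g. f N g - h N g"
  by (rule cf_rel_map2)

lift_definition times_cf :: "'a cf \<Rightarrow> 'a cf \<Rightarrow> 'a cf" is "\<lambda>f h N g. f N g * h N g"
  by (rule cf_rel_map2)

lift_definition uminus_cf :: "'a cf \<Rightarrow> 'a cf" is "\<lambda>f N g. - f N g"
  by (rule cf_rel_map)

instance
proof
  fix a b c :: "'a cf"
  show "a * b * c = a * (b * c)"
    by transfer (rule cf_rel_eq, auto simp: cf_rel_refl class_family_ops algebra_simps)
  show "a * b = b * a"
    by transfer (rule cf_rel_eq, auto simp: cf_rel_refl class_family_ops algebra_simps)
  show "1 * a = a"
    by transfer (auto simp: cf_rel_refl)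
  show "a + b + c = a + (b + c)"
    by transfer (rule cf_rel_eq, auto simp: cf_rel_refl class_family_ops algebra_simps)
  show "a + b = b + a"
    by transfer (rule cf_rel_eq, auto simp: cf_rel_refl class_family_ops algebra_simps)
  show "0 + a = a"
    by transfer (auto simp: cf_rel_refl)
  show "- a + a = 0"
    by transfer (auto simp: cf_rel_refl class_family_const)
  show "a - b = a + - b"
    by transfer (rule cf_rel_eq, auto simp: cf_rel_refl class_family_ops algebra_simps)
  show "(a + b) * c = a * c + b * c"
    by transfer (rule cf_rel_eq, auto simp: cf_rel_refl class_family_ops algebra_simps)
  show "(0 :: 'a cf) \<noteq> 1"
  proof transfer
    have "(1\<^sub>m N :: 'a mat) \<in> GL N" for N
      unfolding GL_def invertible_mat_def inverts_mat_def by (auto intro!: exI[of _ "1\<^sub>m N"])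
    thus "\<not> cf_rel (\<lambda>_ (_ :: 'a mat). 0) (\<lambda>_ _. 1)"
      by (auto simp: cf_rel_def eventually_sequentially)
  qed
qed

end

lift_definition cf_scale :: "complex \<Rightarrow> 'a :: field cf \<Rightarrow> 'a cf" is "\<lambda>c f N g. c * f N g"
  by (rule cf_rel_map)

global_interpretation cf: vector_space "cf_scale :: complex \<Rightarrow> 'a :: field cf \<Rightarrow> 'a cf"
proof
  fix a b :: complex and x y :: "'a cf"
  show "cf_scale a (x + y) = cf_scale a x + cf_scale a y"
    by transfer (rule cf_rel_eq, auto simp: cf_rel_refl class_family_ops algebra_simps)
  show "cf_scale (a + b) x = cf_scale a x + cf_scale b x"
    by transfer (rule cf_rel_eq, auto simp: cf_rel_refl class_family_ops algebra_simps)
  show "cf_scale a (cf_scale b x) = cf_scale (a * b) x"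
    by transfer (rule cf_rel_eq, auto simp: cf_rel_refl class_family_ops algebra_simps)
  show "cf_scale 1 x = x"
    by transfer (auto simp: cf_rel_refl)
qed

definition tilde_family :: "'a :: {field, finite} mat \<Rightarrow> nat \<Rightarrow> 'a mat \<Rightarrow> complex" where
  "tilde_family B N g = of_nat (card {M \<in> carrier_mat (dim_row B) N. M * g = B * M})"

text \<open>The parameter of \<^const>\<open>vec_space.rank\<close> is the number of rows.\<close>

definition tilde_fr_family :: "'a :: {field, finite} mat \<Rightarrow> nat \<Rightarrow> 'a mat \<Rightarrow> complex" where
  "tilde_fr_family B N g = of_nat (card
     {M \<in> carrier_mat (dim_row B) N. M * g = B * M \<and> vec_space.rank (dim_row B) M = dim_row B})"

text \<open>The two families consist of class functions, so they lie in the domain of \<^const>\<open>abs_cf\<close>.\<close>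

lemma rank_mult_invertible:
  fixes M :: "'a :: field mat"
  assumes M: "M \<in> carrier_mat m N" and PQ: "P \<in> carrier_mat N N" "Q \<in> carrier_mat N N"
    and inv: "P * Q = 1\<^sub>m N"
  shows "vec_space.rank m (M * P) = vec_space.rank m M"
proof -
  interpret vec_space "TYPE('a)" m .
  have MP: "M * P \<in> carrier_mat m N" using M PQ by simp
  have "col_space (M * P) = col_space M"
  proof (intro equalityI subsetI)
    fix y assume "y \<in> col_space (M * P)"
    then obtain x where x: "x \<in> carrier_vec N" "y = (M * P) *\<^sub>v x" "y \<in> carrier_vec m"
      using col_space_eq[OF MP] MP by auto
    hence "y = M *\<^sub>v (P *\<^sub>v x)" using M PQ by (simp add: assoc_mult_mat_vec)
    thus "y \<in> col_space M"
      using col_space_eq[OF M] M PQ x by (auto intro!: bexI[of _ "P *\<^sub>v x"])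
  next
    fix y assume "y \<in> col_space M"
    then obtain x where x: "x \<in> carrier_vec N" "y = M *\<^sub>v x" "y \<in> carrier_vec m"
      using col_space_eq[OF M] M by auto
    have "(M * P) *\<^sub>v (Q *\<^sub>v x) = M *\<^sub>v ((P * Q) *\<^sub>v x)"
      using M PQ x by (simp add: assoc_mult_mat_vec)
    hence "y = (M * P) *\<^sub>v (Q *\<^sub>v x)" using x inv by simp
    thus "y \<in> col_space (M * P)"
      using col_space_eq[OF MP] MP M PQ x by (auto intro!: bexI[of _ "Q *\<^sub>v x"])
  qed
  thus ?thesis by (simp add: rank_def col_space_def)
qed

lemma class_fun_card_intertwiners:
  fixes B :: "'a :: field mat"
  assumes B: "B \<in> carrier_mat m m"
    and inv: "\<And>M P Q. M \<in> carrier_mat m N \<Longrightarrow> P \<in> carrier_mat N N \<Longrightarrow> Q \<in> carrier_mat N N \<Longrightarrow>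
      P * Q = 1\<^sub>m N \<Longrightarrow> R M \<Longrightarrow> R (M * P)"
  shows "class_fun N (\<lambda>g. of_nat (card {M \<in> carrier_mat m N. M * g = B * M \<and> R M}))"
proof -
  {
    fix g h :: "'a mat" assume gh: "g \<in> GL N" "h \<in> GL N" "similar_mat g h"
    then obtain P Q where wit: "similar_mat_wit g h P Q" unfolding similar_mat_def by blast
    have "g \<in> carrier_mat N N" using gh(1) by (simp add: GL_def)
    note D = similar_mat_witD2[OF this wit]
    note PQ = D(4,5,6,7,1,2,3)
    have "g * P = P * h * (Q * P)"
      unfolding PQ(7) by (rule assoc_mult_mat[of _ N N _ N _ N]) (use PQ(2-4) in auto)
    hence gP: "g * P = P * h" using PQ(2,3) by (simp add: PQ(6))
    have "Q * g = Q * P * (h * Q)"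
      unfolding PQ(7) using PQ(2-4) by (simp add: assoc_mult_mat[of _ N N _ N _ N])
    hence hQ: "h * Q = Q * g" using PQ(2,4) by (simp add: PQ(6))
    have cancel: "M * P * Q = M" "M * Q * P = M" if "M \<in> carrier_mat m N" for M
      using that PQ(1-6) by (simp_all add: assoc_mult_mat[of _ m N _ N _ N])
    have step: "M * P \<in> {M \<in> carrier_mat m N. M * h = B * M \<and> R M}"
      if "M \<in> {M \<in> carrier_mat m N. M * g = B * M \<and> R M}"
        "P \<in> carrier_mat N N" "Q \<in> carrier_mat N N" "P * Q = 1\<^sub>m N"
        "g * P = P * h" "g \<in> carrier_mat N N" "h \<in> carrier_mat N N" for M P Q g h
    proof -
      have M: "M \<in> carrier_mat m N" "M * g = B * M" "R M" using that(1) by auto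
      have "M * P * h = M * (P * h)" using M(1) that(2,7) by (rule assoc_mult_mat)
      also have "\<dots> = M * (g * P)" by (simp only: that(5))
      also have "\<dots> = M * g * P" using M(1) that(6,2) by (rule assoc_mult_mat[symmetric])
      also have "\<dots> = B * M * P" by (simp only: M(2))
      also have "\<dots> = B * (M * P)" using B M(1) that(2) by (rule assoc_mult_mat)
      finally have "M * P * h = B * (M * P)" .
      moreover have "R (M * P)" using M(1) that(2,3,4) M(3) by (rule inv)
      moreover have "M * P \<in> carrier_mat m N" using M(1) that(2) by (rule mult_carrier_mat)
      ultimately show ?thesis by blast
    qed
    have "bij_betw (\<lambda>M. M * P) {M \<in> carrier_mat m N. M * g = B * M \<and> R M}
        {M \<in> carrier_mat m N. M * h = B * M \<and> R M}"
    proof (rule bij_betw_byWitness[where f' = "\<lambda>M. M * Q"])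
      show "\<forall>M\<in>{M \<in> carrier_mat m N. M * g = B * M \<and> R M}. M * P * Q = M"
        "\<forall>M\<in>{M \<in> carrier_mat m N. M * h = B * M \<and> R M}. M * Q * P = M"
        using cancel by auto
      show "(\<lambda>M. M * P) ` {M \<in> carrier_mat m N. M * g = B * M \<and> R M}
          \<subseteq> {M \<in> carrier_mat m N. M * h = B * M \<and> R M}"
        using step[of _ g P Q h] PQ gP by blast
      show "(\<lambda>M. M * Q) ` {M \<in> carrier_mat m N. M * h = B * M \<and> R M}
          \<subseteq> {M \<in> carrier_mat m N. M * g = B * M \<and> R M}"
        using step[of _ h Q P g] PQ hQ by blast
    qed
    hence "card {M \<in> carrier_mat m N. M * g = B * M \<and> R M} =
        card {M \<in> carrier_mat m N. M * h = B * M \<and> R M}"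
      by (rule bij_betw_same_card)
  }
  thus ?thesis by (auto simp: class_fun_def)
qed

lemma cf_rel_tilde_family:
  assumes "B \<in> GL m"
  shows "cf_rel (tilde_family B) (tilde_family B)"
proof -
  have B: "B \<in> carrier_mat m m" "dim_row B = m" using assms by (auto simp: GL_def)
  show ?thesis
    using class_fun_card_intertwiners[OF B(1), of _ "\<lambda>_. True"]
    by (auto simp: cf_rel_refl class_family_def tilde_family_def[abs_def] B(2))
qed

lemma cf_rel_tilde_fr_family:
  assumes "B \<in> GL m"
  shows "cf_rel (tilde_fr_family B) (tilde_fr_family B)"
proof -
  have B: "B \<in> carrier_mat m m" "dim_row B = m" using assms by (auto simp: GL_def)
  show ?thesis
    using class_fun_card_intertwiners[OF B(1), of _ "\<lambda>M. vec_space.rank m M = m"]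
    by (auto simp: cf_rel_refl class_family_def tilde_fr_family_def[abs_def] B(2)
      rank_mult_invertible)
qed

definition tilde :: "'a :: {field, finite} mat \<Rightarrow> 'a cf" where
  "tilde B = abs_cf (tilde_family B)"

definition tilde_fr :: "'a :: {field, finite} mat \<Rightarrow> 'a cf" where
  "tilde_fr B = abs_cf (tilde_fr_family B)"

definition R :: "nat \<Rightarrow> 'a :: {field, finite} cf set" where
  "R m = cf.span (tilde ` GL m)"

definition R_fr :: "nat \<Rightarrow> 'a :: {field, finite} cf set" where
  "R_fr m = cf.span (tilde_fr ` GL m)"

text \<open>The sums are Minkowski sums of subspaces.\<close>

definition R_le :: "nat \<Rightarrow> 'a :: {field, finite} cf set" where
  "R_le m = (\<Sum>j\<le>m. R j)"

definition R_fr_le :: "nat \<Rightarrow> 'a :: {field, finite} cf set" where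
  "R_fr_le m = (\<Sum>j\<le>m. R_fr j)"

end

theory Submission
  imports Defs
begin

text \<open>Sort the solutions \<open>M\<close> of \<open>M * g = B * M\<close> by their column space \<open>W\<close>. Such a \<open>W\<close> is
  \<open>B\<close>-invariant, because \<open>B\<close> maps the range of \<open>M\<close> to that of \<open>M * g\<close>, which lies in the range
  of \<open>M\<close>. Fix a matrix \<open>E\<close> whose columns are a basis of \<open>W\<close>, and let \<open>k\<close> be the dimension of
  \<open>W\<close>. The restriction of \<open>B\<close> to \<open>W\<close>, written in this basis, is a matrix \<open>C \<in> GL k\<close> with
  \<open>B * E = E * C\<close>, and \<open>F \<mapsto> E * F\<close> is a bijection from the solutions of \<open>F * g = C * F\<close> of
  full rank \<open>k\<close> to the solutions \<open>M\<close> of column space \<open>W\<close>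
  (\<open>restriction_exists\<close>, \<open>card_intertwiners_with_col_space\<close>). Thus \<open>W\<close> contributes exactly
  the full-rank count of \<open>C\<close>. The whole space contributes the full-rank count of \<open>B\<close> itself, and
  every other \<open>W\<close> has \<open>k < m\<close>. The matrices \<open>C\<close> depend on \<open>B\<close> and \<open>W\<close> only, not on \<open>g\<close> or its
  size, so the identity of counts is an identity of families.

  The equality of the two filtrations follows since this expansion is unitriangular in \<open>m\<close>: it
  expresses \<open>tilde B\<close> through full-rank elements, and induction on \<open>m\<close> inverts it.\<close>

section \<open>Finiteness\<close>

lemma finite_carrier_vec: "finite (carrier_vec n :: 'a :: finite vec set)"
proof (rule finite_subset)
  show "carrier_vec n \<subseteq> vec_of_list ` {xs :: 'a list. set xs \<subseteq> UNIV \<and> length xs = n}"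
    by (auto intro!: image_eqI[where x = "list_of_vec v" for v] simp: vec_list)
qed (intro finite_imageI finite_lists_length_eq finite_UNIV)

lemma finite_carrier_mat: "finite (carrier_mat m n :: 'a :: finite mat set)"
proof (rule finite_subset)
  show "(carrier_mat m n :: 'a mat set)
      \<subseteq> mat_of_cols m ` {vs. set vs \<subseteq> carrier_vec m \<and> length vs = n}"
    by (auto intro!: image_eqI[where x = "cols M" for M] simp: cols_dim)
       (use cols_dim in blast)
qed (intro finite_imageI finite_lists_length_eq finite_carrier_vec)

section \<open>Column spaces and rank\<close>

lemma col_space_eq_range:
  fixes M :: "'a :: field mat"
  assumes "M \<in> carrier_mat m n"
  shows "vec_space.col_space m M = (*\<^sub>v) M ` carrier_vec n"
  using vec_space.col_space_eq[OF assms] assms by auto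

text \<open>The rank is defined as the dimension of the column space with a vector space structure of its
  own. A basis chosen among the columns allows arguing inside the ambient space instead.\<close>

lemma (in vec_space) col_space_spanned_by_independent:
  assumes "A \<in> carrier_mat n nc"
  obtains S where "S \<subseteq> carrier_vec n" "finite S" "lin_indpt S" "span S = col_space A"
    "rank A = card S"
proof -
  have sub: "set (cols A) \<subseteq> carrier_vec n" using cols_dim assms by blast
  have "\<exists>S. finite S \<and> maximal S (\<lambda>T. T \<subseteq> set (cols A) \<and> lin_indpt T) \<and> {} \<subseteq> S"
    by (rule maximal_exists_superset[of "set (cols A)"]) (auto simp: finite_lin_indpt2)
  then obtain S where S: "finite S" "maximal S (\<lambda>T. T \<subseteq> set (cols A) \<and> lin_indpt T)" by blast
  hence ind: "S \<subseteq> set (cols A)" "lin_indpt S" by (auto simp: maximal_def)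
  hence Scar: "S \<subseteq> carrier_vec n" using sub by blast
  have "v \<in> span S" if "v \<in> set (cols A)" for v
  proof (rule ccontr)
    assume v: "v \<notin> span S"
    hence "v \<notin> S" using span_mem Scar by auto
    \<comment> \<open>A column outside of the span would enlarge the maximal independent set.\<close>
    moreover have "lin_indpt (insert v S)"
      using lin_dep_iff_in_span[of S v] v \<open>v \<notin> S\<close> Scar ind(2) sub that by auto
    ultimately show False using S(2) ind(1) that unfolding maximal_def by blast
  qed
  hence "span (set (cols A)) \<subseteq> span S" by (intro span_subsetI) (use Scar in auto)
  moreover have "span S \<subseteq> span (set (cols A))" by (rule span_is_monotone[OF ind(1)])
  ultimately have "span S = col_space A" unfolding col_space_def by blast
  thus thesis using that Scar S(1) ind(2) rank_card_indpt[OF assms S(2)] by blast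
qed

lemma (in vec_space) rank_le_dim_row:
  assumes "A \<in> carrier_mat n nc"
  shows "rank A \<le> n"
proof -
  obtain S where "S \<subseteq> carrier_vec n" "lin_indpt S" "rank A = card S"
    by (rule col_space_spanned_by_independent[OF assms])
  thus ?thesis using li_le_dim(2)[of S] by (simp add: dim_is_n)
qed

lemma (in vec_space) rank_eq_dim_row_iff:
  assumes "A \<in> carrier_mat n nc"
  shows "rank A = n \<longleftrightarrow> col_space A = carrier_vec n"
proof -
  obtain S where S: "S \<subseteq> carrier_vec n" "finite S" "lin_indpt S" "span S = col_space A"
    "rank A = card S"
    by (rule col_space_spanned_by_independent[OF assms])
  show ?thesis
  proof
    assume "rank A = n"
    hence "basis S" using S by (intro dim_li_is_basis) (auto simp: dim_is_n)
    thus "col_space A = carrier_vec n" using S(4) by (simp add: basis_def)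
  next
    assume "col_space A = carrier_vec n"
    hence "basis S" using S by (simp add: basis_def)
    thus "rank A = n" using dim_basis[OF S(2)] S(5) dim_is_n by simp
  qed
qed

text \<open>Injectivity on vectors. The form with the kernel is the one that matches linear independence
  of the columns and, for a square matrix, a nonzero determinant.\<close>

definition trivial_kernel :: "'a :: semiring_0 mat \<Rightarrow> bool" where
  "trivial_kernel E \<longleftrightarrow>
     (\<forall>x \<in> carrier_vec (dim_col E). E *\<^sub>v x = 0\<^sub>v (dim_row E) \<longrightarrow> x = 0\<^sub>v (dim_col E))"

text \<open>The columns of \<open>E\<close> are a basis of the column space of \<open>M\<close>.\<close>

lemma trivial_kernel_factor_exists:
  fixes M :: "'a :: field mat"
  assumes M: "M \<in> carrier_mat m n"
  obtains E where "E \<in> carrier_mat m (vec_space.rank m M)" "trivial_kernel E"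
    "vec_space.col_space m E = vec_space.col_space m M"
proof -
  interpret vec_space "TYPE('a)" m .
  obtain S where S: "S \<subseteq> carrier_vec m" "finite S" "lin_indpt S" "span S = col_space M"
    "rank M = card S"
    by (rule col_space_spanned_by_independent[OF M])
  obtain vs where vs: "set vs = S" "distinct vs" using finite_distinct_list[OF S(2)] by blast
  let ?E = "mat_of_cols m vs"
  have E: "?E \<in> carrier_mat m (rank M)" using S(5) vs distinct_card[OF vs(2)] by auto
  have cols: "cols ?E = vs" using vs S(1) by simp
  show thesis
  proof (rule that[OF E])
    show "trivial_kernel ?E"
      unfolding trivial_kernel_def
    proof (intro ballI impI, rule ccontr)
      fix x assume "x \<in> carrier_vec (dim_col ?E)" "?E *\<^sub>v x = 0\<^sub>v (dim_row ?E)"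
        "x \<noteq> 0\<^sub>v (dim_col ?E)"
      hence "lin_dep (set (cols ?E))"
        using lin_depI[OF E, of x] vs(2) carrier_matD[OF E] cols by metis
      thus False using S(3) vs(1) cols by simp
    qed
    show "col_space ?E = col_space M" using S(4) vs cols by (simp add: col_space_def)
  qed
qed

section \<open>Factoring through an injective matrix\<close>

lemma mult_mat_vec_left_cancel:
  fixes E :: "'a :: field mat"
  assumes E: "E \<in> carrier_mat m k" "trivial_kernel E"
    and xy: "x \<in> carrier_vec k" "y \<in> carrier_vec k" "E *\<^sub>v x = E *\<^sub>v y"
  shows "x = y"
proof -
  have "E *\<^sub>v (x - y) = E *\<^sub>v x - E *\<^sub>v y"
    using E xy by (simp add: mult_minus_distrib_mat_vec)
  also have "\<dots> = 0\<^sub>v m" using E xy by auto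
  finally have "x - y = 0\<^sub>v k" using E xy by (simp add: trivial_kernel_def)
  have "x $ i = y $ i" if "i < k" for i
    using arg_cong[OF \<open>x - y = 0\<^sub>v k\<close>, of "\<lambda>v. v $ i"] xy that by simp
  thus ?thesis using xy by (intro eq_vecI) auto
qed

lemma mult_mat_left_cancel:
  fixes E :: "'a :: field mat"
  assumes E: "E \<in> carrier_mat m k" "trivial_kernel E"
    and XY: "X \<in> carrier_mat k n" "Y \<in> carrier_mat k n" "E * X = E * Y"
  shows "X = Y"
proof (rule mat_col_eqI)
  fix j assume "j < dim_col Y"
  hence j: "j < n" using XY by simp
  show "col X j = col Y j"
  proof (rule mult_mat_vec_left_cancel[OF E])
    show "E *\<^sub>v col X j = E *\<^sub>v col Y j"
      using XY(3) col_mult2[OF E(1) XY(1) j] col_mult2[OF E(1) XY(2) j] by simp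
  qed (use XY j in auto)
qed (use XY in auto)

lemma factor_through_col_space:
  fixes E X :: "'a :: field mat"
  assumes E: "E \<in> carrier_mat m k" and X: "X \<in> carrier_mat m n"
    and sub: "vec_space.col_space m X \<subseteq> vec_space.col_space m E"
  obtains F where "F \<in> carrier_mat k n" "X = E * F"
proof -
  have "\<exists>f \<in> carrier_vec k. E *\<^sub>v f = col X j" if "j < n" for j
  proof -
    have "X *\<^sub>v unit_vec n j = col X j"
      using col_mult2[OF X one_carrier_mat that] X that by simp
    hence "col X j \<in> vec_space.col_space m X"
      using col_space_eq_range[OF X] by (metis imageI unit_vec_carrier)
    thus ?thesis using sub col_space_eq_range[OF E] by force
  qed
  then obtain f where f: "\<And>j. j < n \<Longrightarrow> f j \<in> carrier_vec k \<and> E *\<^sub>v f j = col X j" by metis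
  let ?F = "mat_of_cols k (map f [0..<n])"
  have F: "?F \<in> carrier_mat k n" by auto
  have "X = E * ?F"
  proof (rule mat_col_eqI)
    fix j assume "j < dim_col (E * ?F)"
    hence j: "j < n" by simp
    have "col ?F j = f j" using j f by (subst col_mat_of_cols) auto
    thus "col X j = col (E * ?F) j" using col_mult2[OF E F j] f[OF j] by simp
  qed (use E X in auto)
  thus thesis using that F by blast
qed

lemma col_space_mult:
  fixes E F :: "'a :: field mat"
  assumes E: "E \<in> carrier_mat m k" and F: "F \<in> carrier_mat k n"
  shows "vec_space.col_space m (E * F) = (*\<^sub>v) E ` vec_space.col_space k F"
  unfolding col_space_eq_range[OF mult_carrier_mat[OF E F]] col_space_eq_range[OF F] image_image
  by (rule image_cong[OF refl]) (rule assoc_mult_mat_vec[OF E F])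

text \<open>An injective \<open>E\<close> maps distinct subspaces to distinct subspaces, so \<open>E * F\<close> has the full
  range of \<open>E\<close> exactly if \<open>F\<close> is surjective. This translates the condition on the column space of
  \<open>M = E * F\<close> into the full-rank condition on \<open>F\<close>.\<close>

lemma col_space_mult_eq_iff:
  fixes E F :: "'a :: field mat"
  assumes E: "E \<in> carrier_mat m k" "trivial_kernel E" and F: "F \<in> carrier_mat k n"
  shows "vec_space.col_space m (E * F) = vec_space.col_space m E
    \<longleftrightarrow> vec_space.rank k F = k"
proof -
  have "inj_on ((*\<^sub>v) E) (carrier_vec k)"
    by (rule inj_onI, rule mult_mat_vec_left_cancel[OF E])
  moreover have "vec_space.col_space k F \<subseteq> carrier_vec k"
    using F by (auto simp: col_space_eq_range)
  ultimately show ?thesis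
    by (simp add: col_space_mult[OF E(1) F] col_space_eq_range[OF E(1)]
        inj_on_image_eq_iff vec_space.rank_eq_dim_row_iff[OF F])
qed

section \<open>Restriction to an invariant subspace\<close>

lemma GL_iff_trivial_kernel:
  fixes C :: "'a :: field mat"
  assumes C: "C \<in> carrier_mat k k"
  shows "C \<in> GL k \<longleftrightarrow> trivial_kernel C"
proof
  assume "C \<in> GL k"
  then obtain D where CD: "C * D = 1\<^sub>m k" "D * C = 1\<^sub>m (dim_row D)"
    using C by (auto simp: GL_def invertible_mat_def inverts_mat_def)
  from arg_cong[OF CD(1), of dim_col] arg_cong[OF CD(2), of dim_col]
  have D: "D \<in> carrier_mat k k" using C by auto
  show "trivial_kernel C"
    unfolding trivial_kernel_def
  proof (intro ballI impI)
    fix x assume x: "x \<in> carrier_vec (dim_col C)" "C *\<^sub>v x = 0\<^sub>v (dim_row C)"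
    have "x = (D * C) *\<^sub>v x" using CD(2) D C x by simp
    also have "\<dots> = D *\<^sub>v (C *\<^sub>v x)" using D C x by (intro assoc_mult_mat_vec) auto
    also have "\<dots> = 0\<^sub>v (dim_col C)" using D C x by auto
    finally show "x = 0\<^sub>v (dim_col C)" .
  qed
next
  assume "trivial_kernel C"
  hence "det C \<noteq> 0"
    using C det_0_iff_vec_prod_zero_field[OF C] by (auto simp: trivial_kernel_def)
  from det_non_zero_imp_unit[OF C this, of "()"] obtain D where
    "D \<in> carrier_mat k k" "C * D = 1\<^sub>m k" "D * C = 1\<^sub>m k"
    by (auto simp: Units_def ring_mat_def)
  thus "C \<in> GL k" using C by (auto simp: GL_def invertible_mat_def inverts_mat_def)
qed

text \<open>Here \<open>C\<close> is the matrix of the restriction of \<open>B\<close> to the column space of \<open>M\<close>, in the basis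
  formed by the columns of \<open>E\<close>. It is invertible because the restriction of an injective map is
  injective.\<close>

lemma restriction_exists:
  fixes B :: "'a :: field mat"
  assumes B: "B \<in> GL m" and M: "M \<in> carrier_mat m n"
    and inv: "(*\<^sub>v) B ` vec_space.col_space m M \<subseteq> vec_space.col_space m M"
  obtains E C where "E \<in> carrier_mat m (vec_space.rank m M)" "trivial_kernel E"
    "vec_space.col_space m E = vec_space.col_space m M" "C \<in> GL (vec_space.rank m M)"
    "B * E = E * C"
proof -
  let ?k = "vec_space.rank m M"
  obtain E where E: "E \<in> carrier_mat m ?k" "trivial_kernel E"
    "vec_space.col_space m E = vec_space.col_space m M"
    by (rule trivial_kernel_factor_exists[OF M])
  have Bc: "B \<in> carrier_mat m m" using B by (simp add: GL_def)
  have kerB: "trivial_kernel B" using B Bc GL_iff_trivial_kernel by blast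
  have BE: "B * E \<in> carrier_mat m ?k" using Bc E(1) by (rule mult_carrier_mat)
  have "vec_space.col_space m (B * E) \<subseteq> vec_space.col_space m E"
    using inv E(3) by (simp add: col_space_mult[OF Bc E(1)])
  then obtain C where C: "C \<in> carrier_mat ?k ?k" "B * E = E * C"
    using factor_through_col_space[OF E(1) BE] by blast
  have "trivial_kernel C"
    unfolding trivial_kernel_def
  proof (intro ballI impI)
    fix x assume "x \<in> carrier_vec (dim_col C)" and Cx: "C *\<^sub>v x = 0\<^sub>v (dim_row C)"
    hence x: "x \<in> carrier_vec ?k" using C by simp
    have "B *\<^sub>v (E *\<^sub>v x) = (B * E) *\<^sub>v x" using assoc_mult_mat_vec[OF Bc E(1) x] by simp
    also have "\<dots> = E *\<^sub>v (C *\<^sub>v x)" using assoc_mult_mat_vec[OF E(1) C(1) x] C(2) by simp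
    also have "\<dots> = 0\<^sub>v m" using Cx E(1) C by auto
    finally have "E *\<^sub>v x = 0\<^sub>v m" using kerB Bc E(1) x by (auto simp: trivial_kernel_def)
    thus "x = 0\<^sub>v (dim_col C)" using E x C by (auto simp: trivial_kernel_def)
  qed
  hence "C \<in> GL ?k" using GL_iff_trivial_kernel[OF C(1)] by simp
  thus thesis using that E C(2) by blast
qed

text \<open>The bijection is \<open>F \<mapsto> E * F\<close>. Since \<open>E * F * g = E * (F * g)\<close> and
  \<open>B * (E * F) = E * (C * F)\<close>, cancelling \<open>E\<close> turns the equation for \<open>B\<close> into the one for \<open>C\<close>.\<close>

lemma card_intertwiners_with_col_space:
  fixes B :: "'a :: field mat"
  assumes B: "B \<in> carrier_mat m m" and C: "C \<in> carrier_mat k k"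
    and E: "E \<in> carrier_mat m k" "trivial_kernel E" and BE: "B * E = E * C"
    and g: "g \<in> carrier_mat n n"
  shows "card {M \<in> carrier_mat m n. M * g = B * M \<and>
        vec_space.col_space m M = vec_space.col_space m E} =
      card {F \<in> carrier_mat k n. F * g = C * F \<and> vec_space.rank k F = k}"
    (is "card ?\<M> = card ?\<F>")
proof -
  have intertwines_iff: "E * F * g = B * (E * F) \<longleftrightarrow> F * g = C * F" if F: "F \<in> carrier_mat k n" for F
  proof -
    have "E * F * g = E * (F * g)" using E(1) F g by (rule assoc_mult_mat)
    moreover have "B * (E * F) = E * (C * F)"
      using assoc_mult_mat[OF B E(1) F] assoc_mult_mat[OF E(1) C F] BE by simp
    moreover have "F * g \<in> carrier_mat k n" "C * F \<in> carrier_mat k n" using F C g by auto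
    ultimately show ?thesis using mult_mat_left_cancel[OF E, of "F * g" n "C * F"] by auto
  qed
  have "bij_betw ((*) E) ?\<F> ?\<M>"
    unfolding bij_betw_def
  proof
    show "inj_on ((*) E) ?\<F>" by (rule inj_onI, rule mult_mat_left_cancel[OF E]) auto
    show "(*) E ` ?\<F> = ?\<M>"
    proof (intro equalityI subsetI)
      fix M assume "M \<in> (*) E ` ?\<F>"
      thus "M \<in> ?\<M>" using intertwines_iff col_space_mult_eq_iff[OF E] E(1) by auto
    next
      fix M assume M: "M \<in> ?\<M>"
      then obtain F where F: "F \<in> carrier_mat k n" "M = E * F"
        using factor_through_col_space[OF E(1), of M n] by auto
      thus "M \<in> (*) E ` ?\<F>" using M intertwines_iff col_space_mult_eq_iff[OF E] by auto
    qed
  qed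
  thus ?thesis by (simp add: bij_betw_same_card)
qed

section \<open>Expansion into full-rank counts\<close>

text \<open>The list is chosen before \<open>N\<close> and \<open>g\<close>, which is why it runs over all proper \<open>B\<close>-invariant
  subspaces and not only over the column spaces of solutions for one \<open>g\<close>.\<close>

lemma tilde_family_eq_sum_tilde_fr_family:
  fixes B :: "'a :: {field, finite} mat"
  assumes B: "B \<in> GL m"
  obtains Cs :: "'a mat list" where "\<forall>C \<in> set Cs. \<exists>k<m. C \<in> GL k"
    "\<And>N g. g \<in> GL N \<Longrightarrow> tilde_family B N g =
      tilde_fr_family B N g + (\<Sum>C\<leftarrow>Cs. tilde_fr_family C N g)"
proof -
  have Bc: "B \<in> carrier_mat m m" "dim_row B = m" using B by (auto simp: GL_def)
  let ?I = "\<lambda>N g. {M \<in> carrier_mat m N. M * g = B * M}"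
  \<comment> \<open>Every subspace is the column space of some matrix, so these are the proper invariant
    subspaces.\<close>
  define \<W> where "\<W> = {W. W \<noteq> carrier_vec m \<and> (*\<^sub>v) B ` W \<subseteq> W \<and>
    (\<exists>n. \<exists>M \<in> carrier_mat m n. vec_space.col_space m M = W)}"
  have "\<W> \<subseteq> Pow (carrier_vec m)" by (auto simp: \<W>_def col_space_eq_range)
  hence fin: "finite \<W>" by (rule finite_subset) (simp add: finite_carrier_vec)
  have "\<exists>C. (\<exists>k<m. C \<in> GL k) \<and> (\<forall>N. \<forall>g \<in> GL N. tilde_fr_family C N g =
      of_nat (card {M \<in> ?I N g. vec_space.col_space m M = W}))" if WW: "W \<in> \<W>" for W
  proof -
    obtain n M where M: "M \<in> carrier_mat m n" "vec_space.col_space m M = W"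
      and W: "W \<noteq> carrier_vec m" "(*\<^sub>v) B ` W \<subseteq> W"
      using WW unfolding \<W>_def by blast
    let ?k = "vec_space.rank m M"
    have "?k < m"
      using vec_space.rank_le_dim_row[OF M(1)] vec_space.rank_eq_dim_row_iff[OF M(1)] M(2) W(1)
      by auto
    obtain E C where E: "E \<in> carrier_mat m ?k" "trivial_kernel E"
      "vec_space.col_space m E = vec_space.col_space m M"
      and C: "C \<in> GL ?k" and BE: "B * E = E * C"
      using W(2) M(2) by (auto intro: restriction_exists[OF B M(1)])
    have Cc: "C \<in> carrier_mat ?k ?k" "dim_row C = ?k" using C by (auto simp: GL_def)
    have "tilde_fr_family C N g = of_nat (card {M \<in> ?I N g. vec_space.col_space m M = W})"
      if "g \<in> GL N" for N g
      using card_intertwiners_with_col_space[OF Bc(1) Cc(1) E(1,2) BE, of g N] that E(3) M(2) Cc(2)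
      by (simp add: tilde_fr_family_def GL_def conj_assoc)
    thus ?thesis using \<open>?k < m\<close> C by blast
  qed
  hence "\<forall>W \<in> \<W>. \<exists>C. (\<exists>k<m. C \<in> GL k) \<and> (\<forall>N. \<forall>g \<in> GL N. tilde_fr_family C N g =
      of_nat (card {M \<in> ?I N g. vec_space.col_space m M = W}))" by (rule ballI)
  from bchoice[OF this] obtain c where
    "\<forall>W \<in> \<W>. (\<exists>k<m. c W \<in> GL k) \<and> (\<forall>N. \<forall>g \<in> GL N. tilde_fr_family (c W) N g =
      of_nat (card {M \<in> ?I N g. vec_space.col_space m M = W}))" ..
  hence c: "\<And>W. W \<in> \<W> \<Longrightarrow> \<exists>k<m. c W \<in> GL k"
    "\<And>W N g. W \<in> \<W> \<Longrightarrow> g \<in> GL N \<Longrightarrow> tilde_fr_family (c W) N g =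
      of_nat (card {M \<in> ?I N g. vec_space.col_space m M = W})" by simp_all
  obtain Ws where Ws: "set Ws = \<W>" "distinct Ws" using finite_distinct_list[OF fin] by blast
  show thesis
  proof (rule that[of "map c Ws"])
    show "\<forall>C \<in> set (map c Ws). \<exists>k<m. C \<in> GL k" using c(1) Ws(1) by auto
    fix N and g :: "'a mat" assume gGL: "g \<in> GL N"
    hence g: "g \<in> carrier_mat N N" by (simp add: GL_def)
    have finI: "finite (?I N g)" by (rule finite_subset[OF _ finite_carrier_mat]) auto
    have "vec_space.col_space m M \<in> insert (carrier_vec m) \<W>" if "M \<in> ?I N g" for M
    proof -
      have M: "M \<in> carrier_mat m N" "M * g = B * M" using that by auto
      have "(*\<^sub>v) B ` vec_space.col_space m M = vec_space.col_space m (M * g)"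
        using col_space_mult[OF Bc(1) M(1)] M(2) by simp
      also have "\<dots> = (*\<^sub>v) M ` vec_space.col_space N g" by (rule col_space_mult[OF M(1) g])
      also have "\<dots> \<subseteq> vec_space.col_space m M"
        using g by (auto simp: col_space_eq_range[OF M(1)] col_space_eq_range[OF g])
      finally show ?thesis using M(1) by (auto simp: \<W>_def)
    qed
    \<comment> \<open>Count the solutions by the fibres of \<open>M \<mapsto> col_space M\<close>.\<close>
    hence "card (?I N g) =
        (\<Sum>W \<in> insert (carrier_vec m) \<W>. card {M \<in> ?I N g. vec_space.col_space m M = W})"
      using sum.group[OF finI, of "insert (carrier_vec m) \<W>" "vec_space.col_space m" "\<lambda>_. 1 :: nat"]
        fin by (simp add: image_subset_iff)
    also have "\<dots> = card {M \<in> ?I N g. vec_space.col_space m M = carrier_vec m} +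
        (\<Sum>W \<in> \<W>. card {M \<in> ?I N g. vec_space.col_space m M = W})"
      using fin by (subst sum.insert) (auto simp: \<W>_def)
    also have "{M \<in> ?I N g. vec_space.col_space m M = carrier_vec m} =
        {M \<in> carrier_mat m N. M * g = B * M \<and> vec_space.rank m M = m}"
      using vec_space.rank_eq_dim_row_iff by blast
    finally have "tilde_family B N g =
        tilde_fr_family B N g + (\<Sum>W \<in> \<W>. tilde_fr_family (c W) N g)"
      using c(2) gGL by (simp add: tilde_family_def tilde_fr_family_def Bc(2))
    also have "(\<Sum>W \<in> \<W>. tilde_fr_family (c W) N g) =
        (\<Sum>C\<leftarrow>map c Ws. tilde_fr_family C N g)"
      using sum_list_distinct_conv_sum_set[OF Ws(2), of "\<lambda>W. tilde_fr_family (c W) N g"] Ws(1)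
      by (simp add: o_def)
    finally show "tilde_family B N g =
        tilde_fr_family B N g + (\<Sum>C\<leftarrow>map c Ws. tilde_fr_family C N g)" .
  qed
qed

lemma sum_list_tilde_fr:
  fixes Cs :: "'a :: {field, finite} mat list"
  assumes "\<forall>C \<in> set Cs. \<exists>k. C \<in> GL k"
  shows "class_family (\<lambda>N g. \<Sum>C\<leftarrow>Cs. tilde_fr_family C N g)"
    and "(\<Sum>C\<leftarrow>Cs. tilde_fr C) = abs_cf (\<lambda>N g. \<Sum>C\<leftarrow>Cs. tilde_fr_family C N g)"
proof -
  have "class_family (\<lambda>N g. \<Sum>C\<leftarrow>Cs. tilde_fr_family C N g) \<and>
    (\<Sum>C\<leftarrow>Cs. tilde_fr C) = abs_cf (\<lambda>N g. \<Sum>C\<leftarrow>Cs. tilde_fr_family C N g)"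
    using assms
  proof (induction Cs)
    case Nil
    show ?case by (simp add: class_family_const zero_cf_def)
  next
    case (Cons C Cs)
    have "class_family (tilde_fr_family C)"
      using Cons.prems cf_rel_tilde_fr_family by (auto simp: cf_rel_refl)
    thus ?case
      using Cons by (auto simp: tilde_fr_def plus_cf.abs_eq cf_rel_refl class_family_ops)
  qed
  thus "class_family (\<lambda>N g. \<Sum>C\<leftarrow>Cs. tilde_fr_family C N g)"
    "(\<Sum>C\<leftarrow>Cs. tilde_fr C) = abs_cf (\<lambda>N g. \<Sum>C\<leftarrow>Cs. tilde_fr_family C N g)" by auto
qed

lemma tilde_eq_sum_tilde_fr:
  fixes B :: "'a :: {field, finite} mat"
  assumes B: "B \<in> GL m"
  obtains Cs :: "'a mat list" where "\<forall>C \<in> set Cs. \<exists>k<m. C \<in> GL k"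
    "tilde B = tilde_fr B + (\<Sum>C\<leftarrow>Cs. tilde_fr C)"
proof -
  obtain Cs where Cs: "\<forall>C \<in> set Cs. \<exists>k<m. C \<in> GL k"
    "\<And>N g. g \<in> GL N \<Longrightarrow> tilde_family B N g =
      tilde_fr_family B N g + (\<Sum>C\<leftarrow>Cs. tilde_fr_family C N g)"
    by (rule tilde_family_eq_sum_tilde_fr_family[OF B]) blast
  have "\<forall>C \<in> set Cs. \<exists>k. C \<in> GL k" using Cs(1) by blast
  note sum = sum_list_tilde_fr[OF this]
  have fr: "class_family (tilde_fr_family B)" "class_family (tilde_family B)"
    using cf_rel_tilde_fr_family[OF B] cf_rel_tilde_family[OF B] by (auto simp: cf_rel_refl)
  let ?S = "\<lambda>N g. tilde_fr_family B N g + (\<Sum>C\<leftarrow>Cs. tilde_fr_family C N g)"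
  have "cf_rel (tilde_family B) ?S"
    using class_family_ops(1)[OF fr(1) sum(1)] fr(2) Cs(2) by (auto simp: cf_rel_def)
  hence "tilde B = abs_cf ?S"
    unfolding tilde_def using Quotient_rel_abs[OF Quotient_cf] by blast
  also have "\<dots> = tilde_fr B + (\<Sum>C\<leftarrow>Cs. tilde_fr C)"
    using sum fr(1) by (simp add: tilde_fr_def plus_cf.abs_eq cf_rel_refl)
  finally show thesis using that Cs(1) by blast
qed

section \<open>Equality of the filtrations\<close>

lemma (in vector_space) sum_span_eq_span_UN:
  "(\<Sum>j\<le>m. span (A j)) = span (\<Union>j\<le>(m::nat). A j)"
proof (induction m)
  case (Suc m)
  have "(\<Sum>j\<le>Suc m. span (A j)) = span (\<Union>j\<le>m. A j) + span (A (Suc m))"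
    using Suc by simp
  also have "\<dots> = span ((\<Union>j\<le>m. A j) \<union> A (Suc m))"
    by (auto simp: span_Un set_plus_def)
  also have "(\<Union>j\<le>m. A j) \<union> A (Suc m) = (\<Union>j\<le>Suc m. A j)"
    by (auto simp: atMost_Suc)
  finally show ?case .
qed simp

lemma (in vector_space) span_sum_list:
  assumes "\<And>x. x \<in> set xs \<Longrightarrow> f x \<in> span A"
  shows "(\<Sum>x\<leftarrow>xs. f x) \<in> span A"
  using assms by (induction xs) (auto intro: span_zero span_add)

lemma R_le_eq_R_fr_le: "(R_le m :: 'a :: {field, finite} cf set) = R_fr_le m"
proof -
  let ?T = "\<Union>j\<le>m. tilde ` (GL j :: 'a mat set)"
  let ?F = "\<Union>j\<le>m. tilde_fr ` (GL j :: 'a mat set)"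
  have "tilde B \<in> cf.span ?F" if B: "B \<in> (GL j :: 'a mat set)" "j \<le> m" for j B
  proof -
    obtain Cs where Cs: "\<forall>C \<in> set Cs. \<exists>k<j. C \<in> GL k"
      "tilde B = tilde_fr B + (\<Sum>C\<leftarrow>Cs. tilde_fr C)"
      by (rule tilde_eq_sum_tilde_fr[OF B(1)])
    have "tilde_fr C \<in> cf.span ?F" if C: "C \<in> set Cs" for C
    proof -
      obtain k where "k < j" "C \<in> GL k" using Cs(1) C by blast
      thus ?thesis using B(2) by (intro cf.span_base) auto
    qed
    thus ?thesis
      unfolding Cs(2) using B by (intro cf.span_add cf.span_sum_list) (auto intro: cf.span_base)
  qed
  hence T: "?T \<subseteq> cf.span ?F" by auto
  have "tilde_fr B \<in> cf.span ?T" if "B \<in> (GL j :: 'a mat set)" "j \<le> m" for j B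
    using that
  proof (induction j arbitrary: B rule: less_induct)
    case (less j)
    obtain Cs where Cs: "\<forall>C \<in> set Cs. \<exists>k<j. C \<in> GL k"
      "tilde B = tilde_fr B + (\<Sum>C\<leftarrow>Cs. tilde_fr C)"
      by (rule tilde_eq_sum_tilde_fr[OF less.prems(1)])
    \<comment> \<open>Solve the expansion for its leading term: the remaining \<open>C\<close> have smaller size.\<close>
    have "tilde_fr C \<in> cf.span ?T" if C: "C \<in> set Cs" for C
    proof -
      obtain k where "k < j" "C \<in> GL k" using Cs(1) C by blast
      thus ?thesis using less.IH[of k C] less.prems(2) by simp
    qed
    moreover have "tilde B \<in> cf.span ?T"
      using less.prems by (intro cf.span_base) auto
    moreover have "tilde_fr B = tilde B - (\<Sum>C\<leftarrow>Cs. tilde_fr C)" using Cs(2) by simp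
    ultimately show ?case by (simp add: cf.span_diff cf.span_sum_list)
  qed
  hence F: "?F \<subseteq> cf.span ?T" by auto
  show ?thesis
    unfolding R_le_def R_fr_le_def R_def R_fr_def cf.sum_span_eq_span_UN
    using T F by (simp add: cf.span_eq)
qed

theorem proposition2p2:
  shows "(\<forall>m. \<forall>B \<in> (GL m :: 'a :: {field, finite} mat set).
            \<exists>Cs :: 'a mat list.
              (\<forall>C \<in> set Cs. \<exists>k<m. C \<in> GL k) \<and>
              tilde B = tilde_fr B + (\<Sum>C\<leftarrow>Cs. tilde_fr C))
       \<and> (\<forall>m. (R_le m :: 'a cf set) = R_fr_le m)"
proof (intro conjI allI ballI)
  fix m and B :: "'a mat" assume B: "B \<in> GL m"
  obtain Cs where "\<forall>C \<in> set Cs. \<exists>k<m. C \<in> GL k"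
    "tilde B = tilde_fr B + (\<Sum>C\<leftarrow>Cs. tilde_fr C)"
    by (rule tilde_eq_sum_tilde_fr[OF B])
  thus "\<exists>Cs :: 'a mat list. (\<forall>C \<in> set Cs. \<exists>k<m. C \<in> GL k) \<and>
      tilde B = tilde_fr B + (\<Sum>C\<leftarrow>Cs. tilde_fr C)" by blast
qed (rule R_le_eq_R_fr_le)

end
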